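(* There is a function $f$ such that, for each $\tau\ge 2$, the number of irreducible facet inducing Steiner graphs $(G,T)$ with $|T|=\tau$ is, up to isomorphism, bounded by $f(\tau)$.
   Context: Graphs are finite and have no loops or multiple edges. A Steiner graph $(G,T)$ consists of a connected graph $G$ with node set $V(G)$ and edge set $E(G)$ and a set $T\subseteq V(G)$ of terminals with $|T|\ge 2$. An isomorphism of Steiner graphs is a graph isomorphism mapping the terminal set onto the terminal set. For $S\subseteq V(G)$, $\delta(S)$ is the set of edges with exactly one endnode in $S$. The cut $\delta(S)$ is a $T$-Steiner cut if $T\cap S\neq\varnothing$ and $T\setminus S\neq\varnothing$. The $T$-Steiner cut dominant is $\mathrm{CUT}_+(G,T)=\mathrm{conv}\{\chi(\delta(S)) : \delta(S)\text{ a }T\text{-Steiner cut}\}+\mathbb{R}_{\ge 0}^{E(G)}$, where $\chi(\cdot)$ denotes the $0/1$ incidence vector in $\mathbb{R}^{E(G)}$. For $c\in\mathbb{R}^{E(G)}$ and $F\subseteq E(G)$, $c(F)=\sum_{e\in F}c_e$. For a nonnegative vector $c$, $\gamma_c(G,T)$ is the minimum of $c(\delta(S))$ over all $T$-Steiner cuts. A vector is in minimum integer form if its components are nonnegative integers with greatest common divisor one. A vector $c$ provides facet weights for $(G,T)$ if $c$ is in minimum integer form, $c_e>0$ for all $e\in E(G)$, $\gamma_c(G,T)>0$, and $cx\ge\gamma_c(G,T)$ defines a facet of $\mathrm{CUT}_+(G,T)$; $(G,T)$ is facet inducing if it has facet weights. A facet inducing Steiner graph $(G,T)$ is irreducible if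 $G$ has no cut node (a node $w$ such that $G\setminus w$, the graph with $w$ and its incident edges removed, is disconnected) and no node in $V(G)\setminus T$ has degree two. *)

theory Defs
  imports "HOL-Analysis.Analysis" "HOL-Library.Function_Algebras"
begin

text \<open>
  The edge set varies with the graph, so the space of real vectors indexed by a finite set of
  edges is represented as the subspace of those functions into the reals that vanish outside
  this set.  With the pointwise vector space structure on functions, the library notions
  \<^const>\<open>convex\<close>, \<^const>\<open>hull\<close>, \<^const>\<open>face_of\<close> and \<^const>\<open>affine_dependent\<close> apply.
\<close>

instantiation "fun" :: (type, real_vector) real_vector
begin

definition scaleR_fun_def: "scaleR a f = (\<lambda>x. a *\<^sub>R f x)"

instance
  by intro_classes (auto simp: scaleR_fun_def fun_eq_iff scaleR_add_right scaleR_add_left)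

end

lemma scaleR_fun_apply [simp]: "(a *\<^sub>R f) x = a *\<^sub>R f x"
  by (simp add: scaleR_fun_def)

definition coord_space :: "'e set \<Rightarrow> ('e \<Rightarrow> real) set" where
  "coord_space E = {x. \<forall>e. e \<notin> E \<longrightarrow> x e = 0}"

text \<open>
  The library restricts \<^const>\<open>aff_dim\<close> and \<^const>\<open>facet_of\<close> to Euclidean spaces.  The next two
  definitions are those of the library, word for word, at the more general class of real vector
  spaces; they are only applied to subsets of the finite-dimensional spaces
  \<^term>\<open>coord_space E\<close> for finite \<^term>\<open>E\<close>.
\<close>

definition affine_dim :: "'a::real_vector set \<Rightarrow> int" where
  "affine_dim V =
    (SOME d :: int.
      \<exists>B. affine hull B = affine hull V \<and> \<not> affine_dependent B \<and> of_nat (card B) = d + 1)"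

definition is_facet_of :: "'a::real_vector set \<Rightarrow> 'a set \<Rightarrow> bool" where
  "is_facet_of F P \<longleftrightarrow> F face_of P \<and> F \<noteq> {} \<and> affine_dim F = affine_dim P - 1"

lemma affine_dim_eq_aff_dim:
  fixes V :: "'a::euclidean_space set"
  shows "affine_dim V = aff_dim V"
  by (simp add: affine_dim_def aff_dim_def)

lemma is_facet_of_iff_facet_of:
  fixes P :: "'a::euclidean_space set"
  shows "is_facet_of F P \<longleftrightarrow> F facet_of P"
  by (simp add: is_facet_of_def facet_of_def affine_dim_eq_aff_dim)

definition defines_facet :: "'e set \<Rightarrow> ('e \<Rightarrow> real) \<Rightarrow> real \<Rightarrow> ('e \<Rightarrow> real) set \<Rightarrow> bool" where
  "defines_facet E c b P \<longleftrightarrow>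
     (\<forall>x\<in>P. (\<Sum>e\<in>E. c e * x e) \<ge> b) \<and>
     is_facet_of {x \<in> P. (\<Sum>e\<in>E. c e * x e) = b} P"

definition simple_graph :: "'v set \<Rightarrow> 'v set set \<Rightarrow> bool" where
  "simple_graph V E \<longleftrightarrow> finite V \<and> (\<forall>e\<in>E. \<exists>u\<in>V. \<exists>v\<in>V. u \<noteq> v \<and> e = {u, v})"

definition connected_graph :: "'v set \<Rightarrow> 'v set set \<Rightarrow> bool" where
  "connected_graph V E \<longleftrightarrow> V \<noteq> {} \<and> (\<forall>u\<in>V. \<forall>v\<in>V. (u, v) \<in> {(a, b). {a, b} \<in> E}\<^sup>*)"

definition node_degree :: "'v set set \<Rightarrow> 'v \<Rightarrow> nat" where
  "node_degree E v = card {e \<in> E. v \<in> e}"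

definition cut_node :: "'v set \<Rightarrow> 'v set set \<Rightarrow> 'v \<Rightarrow> bool" where
  "cut_node V E w \<longleftrightarrow> w \<in> V \<and> \<not> connected_graph (V - {w}) {e \<in> E. w \<notin> e}"

record 'v steiner =
  nodes :: "'v set"
  edges :: "'v set set"
  terminals :: "'v set"

definition steiner_graph :: "'v steiner \<Rightarrow> bool" where
  "steiner_graph G \<longleftrightarrow>
     simple_graph (nodes G) (edges G) \<and> connected_graph (nodes G) (edges G) \<and>
     terminals G \<subseteq> nodes G \<and> card (terminals G) \<ge> 2"

definition steiner_iso :: "'v steiner \<Rightarrow> 'w steiner \<Rightarrow> bool" where
  "steiner_iso G H \<longleftrightarrow>
     (\<exists>f. bij_betw f (nodes G) (nodes H) \<and>
          (\<forall>u\<in>nodes G. \<forall>v\<in>nodes G. {u, v} \<in> edges G \<longleftrightarrow> {f u, f v} \<in> edges H) \<and>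
          f ` terminals G = terminals H)"

definition steiner_iso_rel :: "('v steiner \<times> 'v steiner) set" where
  "steiner_iso_rel = {(G, H). steiner_graph G \<and> steiner_graph H \<and> steiner_iso G H}"

lemma equiv_steiner_iso_rel: "equiv {G :: 'v steiner. steiner_graph G} steiner_iso_rel"
proof (rule equivI)
  show "steiner_iso_rel \<subseteq> {G :: 'v steiner. steiner_graph G} \<times> {G. steiner_graph G}"
    by (auto simp: steiner_iso_rel_def)
  show "refl_on {G :: 'v steiner. steiner_graph G} steiner_iso_rel"
    by (auto simp: refl_on_def steiner_iso_rel_def steiner_iso_def intro!: exI[of _ id])
  show "sym (steiner_iso_rel :: ('v steiner \<times> 'v steiner) set)"
  proof (rule symI)
    fix G H :: "'v steiner"
    assume "(G, H) \<in> steiner_iso_rel"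
    then obtain f where gr: "steiner_graph G" "steiner_graph H"
      and f: "bij_betw f (nodes G) (nodes H)"
        "\<forall>u\<in>nodes G. \<forall>v\<in>nodes G. {u, v} \<in> edges G \<longleftrightarrow> {f u, f v} \<in> edges H"
        "f ` terminals G = terminals H"
      by (auto simp: steiner_iso_rel_def steiner_iso_def)
    let ?g = "inv_into (nodes G) f"
    have g: "bij_betw ?g (nodes H) (nodes G)"
      using f(1) by (rule bij_betw_inv_into)
    have "{u, v} \<in> edges H \<longleftrightarrow> {?g u, ?g v} \<in> edges G" if "u \<in> nodes H" "v \<in> nodes H" for u v
      using that f(2) bij_betwE[OF g] bij_betw_inv_into_right[OF f(1)] by simp
    moreover have "?g ` terminals H = terminals G"
      using gr f(1,3) by (metis bij_betw_def inv_into_image_cancel steiner_graph_def)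
    ultimately show "(H, G) \<in> steiner_iso_rel"
      using g gr unfolding steiner_iso_rel_def steiner_iso_def by blast
  qed
  show "trans (steiner_iso_rel :: ('v steiner \<times> 'v steiner) set)"
  proof (rule transI)
    fix G H K :: "'v steiner"
    assume "(G, H) \<in> steiner_iso_rel" "(H, K) \<in> steiner_iso_rel"
    then obtain f g where gr: "steiner_graph G" "steiner_graph K"
      and f: "bij_betw f (nodes G) (nodes H)"
        "\<forall>u\<in>nodes G. \<forall>v\<in>nodes G. {u, v} \<in> edges G \<longleftrightarrow> {f u, f v} \<in> edges H"
        "f ` terminals G = terminals H"
      and g: "bij_betw g (nodes H) (nodes K)"
        "\<forall>u\<in>nodes H. \<forall>v\<in>nodes H. {u, v} \<in> edges H \<longleftrightarrow> {g u, g v} \<in> edges K"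
        "g ` terminals H = terminals K"
      by (auto simp: steiner_iso_rel_def steiner_iso_def)
    have "bij_betw (g \<circ> f) (nodes G) (nodes K)"
      using f(1) g(1) by (rule bij_betw_trans)
    moreover have "{u, v} \<in> edges G \<longleftrightarrow> {(g \<circ> f) u, (g \<circ> f) v} \<in> edges K"
      if "u \<in> nodes G" "v \<in> nodes G" for u v
      using that f(2) g(2) bij_betwE[OF f(1)] by simp
    moreover have "(g \<circ> f) ` terminals G = terminals K"
      using f(3) g(3) by (metis image_comp)
    ultimately show "(G, K) \<in> steiner_iso_rel"
      using gr unfolding steiner_iso_rel_def steiner_iso_def by blast
  qed
qed

definition cut :: "'v set set \<Rightarrow> 'v set \<Rightarrow> 'v set set" where
  "cut E S = {e \<in> E. card (e \<inter> S) = 1}"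

definition steiner_cuts :: "'v steiner \<Rightarrow> 'v set set set" where
  "steiner_cuts G =
     {cut (edges G) S | S. S \<subseteq> nodes G \<and> terminals G \<inter> S \<noteq> {} \<and> terminals G - S \<noteq> {}}"

definition cut_dominant :: "'v steiner \<Rightarrow> ('v set \<Rightarrow> real) set" where
  "cut_dominant G =
     {p + r | p r. p \<in> convex hull (indicator ` steiner_cuts G) \<and>
                   r \<in> coord_space (edges G) \<and> (\<forall>e\<in>edges G. r e \<ge> 0)}"

definition min_steiner_cut :: "('v set \<Rightarrow> real) \<Rightarrow> 'v steiner \<Rightarrow> real" where
  "min_steiner_cut c G = Min (sum c ` steiner_cuts G)"

definition min_integer_form :: "'e set \<Rightarrow> ('e \<Rightarrow> real) \<Rightarrow> bool" where
  "min_integer_form E c \<longleftrightarrow>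
     c \<in> coord_space E \<and> (\<exists>k :: 'e \<Rightarrow> nat. (\<forall>e\<in>E. c e = real (k e)) \<and> Gcd (k ` E) = 1)"

definition facet_weights :: "('v set \<Rightarrow> real) \<Rightarrow> 'v steiner \<Rightarrow> bool" where
  "facet_weights c G \<longleftrightarrow>
     min_integer_form (edges G) c \<and> (\<forall>e\<in>edges G. c e > 0) \<and> min_steiner_cut c G > 0 \<and>
     defines_facet (edges G) c (min_steiner_cut c G) (cut_dominant G)"

definition facet_inducing :: "'v steiner \<Rightarrow> bool" where
  "facet_inducing G \<longleftrightarrow> steiner_graph G \<and> (\<exists>c. facet_weights c G)"

definition irreducible_facet_inducing :: "'v steiner \<Rightarrow> bool" where
  "irreducible_facet_inducing G \<longleftrightarrow>
     facet_inducing G \<and>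
     (\<forall>w. \<not> cut_node (nodes G) (edges G) w) \<and>
     (\<forall>v\<in>nodes G - terminals G. node_degree (edges G) v \<noteq> 2)"

end

theory Submission
  imports Defs
begin

text \<open>
  Facet weights \<open>c\<close> are positive, so the facet lies in the span of the minimum Steiner cuts, which
  therefore has dimension \<open>|E|\<close>.  Fix a terminal \<open>t\<close> and describe each cut by its shore avoiding
  \<open>t\<close>.  Two crossing shores can be uncrossed: if they share a terminal, replace them by their
  intersection and union, otherwise by their differences.  Hence the span is already generated by
  a laminar family of shores, each containing a terminal.  Deleting a nonterminal identifies at
  most one pair of members of such a family, so it has at most \<open>|V - T| + 2 ^ |T|\<close> members.  In an
  irreducible graph every nonterminal has degree at least three, thus
  \<open>3 |V - T| \<le> 2 |E| \<le> 2 |V - T| + 2 \<cdot> 2 ^ |T|\<close>, which bounds \<open>|V|\<close> in terms of \<open>|T|\<close>.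
\<close>

section \<open>Laminar families\<close>

text \<open>Such sets are also called intersecting. Nothing is asked of the complement of
  \<open>A \<union> B\<close>: the shores below all avoid \<open>t\<close>, so their union never
  covers all nodes.\<close>

definition crossing :: "'a set \<Rightarrow> 'a set \<Rightarrow> bool" where
  "crossing A B \<longleftrightarrow> A \<inter> B \<noteq> {} \<and> A - B \<noteq> {} \<and> B - A \<noteq> {}"

definition laminar :: "'a set set \<Rightarrow> bool" where
  "laminar L \<longleftrightarrow> (\<forall>A\<in>L. \<forall>B\<in>L. \<not> crossing A B)"

lemma crossing_commute: "crossing A B \<longleftrightarrow> crossing B A"
  unfolding crossing_def by blast

text \<open>Induction over \<open>N\<close>: deleting \<open>v\<close> from every member keeps the
  family laminar and its members touching \<open>T\<close>, and merges at most one pair, so each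
  element of \<open>N\<close> accounts for at most one extra member. For empty \<open>N\<close> only
  subsets of \<open>T\<close> remain.\<close>

lemma card_laminar_le:
  assumes "finite N" "finite T" "N \<inter> T = {}" "laminar L" "L \<subseteq> Pow (N \<union> T)"
    and "\<And>S. S \<in> L \<Longrightarrow> S \<inter> T \<noteq> {}"
  shows "card L \<le> card N + 2 ^ card T"
  using assms
proof (induction N arbitrary: L rule: finite_induct)
  case empty
  then have "card L \<le> card (Pow T)"
    by (intro card_mono) auto
  then show ?case
    using empty by (simp add: card_Pow)
next
  case (insert v N)
  let ?r = "\<lambda>S. S - {v}"
  have finL: "finite L"
    using insert.hyps insert.prems by (meson finite_Pow_iff finite_UnI finite_insert finite_subset)
  have vT: "v \<notin> T"
    using insert.prems by blast
  have "laminar (?r ` L)"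
    using insert.prems(3) unfolding laminar_def crossing_def by blast
  moreover have "S \<inter> T \<noteq> {}" if "S \<in> ?r ` L" for S
    using that insert.prems(5) vT by blast
  moreover have "?r ` L \<subseteq> Pow (N \<union> T)"
    using insert.prems(4) by blast
  ultimately have IH: "card (?r ` L) \<le> card N + 2 ^ card T"
    using insert.prems by (intro insert.IH) auto
  \<comment> \<open>At most one pair of members of a laminar family differs exactly by \<open>v\<close>.\<close>
  have "card L \<le> Suc (card (?r ` L))"
  proof (cases "inj_on ?r L")
    case True
    then show ?thesis
      by (simp add: card_image)
  next
    case False
    then obtain A0 B0 where "A0 \<in> L" "B0 \<in> L" "A0 \<noteq> B0" "A0 - {v} = B0 - {v}"
      unfolding inj_on_def by blast
    then obtain A where A: "A \<in> L" "insert v A \<in> L" "v \<notin> A"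
      by (metis Diff_empty Diff_insert0 insert_Diff)
    have "inj_on ?r (L - {insert v A})"
    proof (rule inj_onI, rule ccontr)
      fix C D
      assume CD: "C \<in> L - {insert v A}" "D \<in> L - {insert v A}" "C - {v} = D - {v}" "C \<noteq> D"
      then obtain B where B: "B \<in> L" "insert v B \<in> L" "v \<notin> B" "B \<noteq> A"
        by (metis Diff_empty Diff_insert0 insert_Diff DiffE singletonI)
      \<comment> \<open>The sets \<open>insert v A\<close> and \<open>insert v B\<close> share
        \<open>v\<close>, so they are nested, say with \<open>A\<close> strictly inside
        \<open>B\<close>. Then \<open>insert v A\<close> and \<open>B\<close> cross: they meet in
        the nonempty \<open>A\<close>, and \<open>v\<close> lies only in the first. The other
        nesting is symmetric.\<close>
      have "\<not> crossing (insert v A) (insert v B)" "\<not> crossing A (insert v B)"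
          "\<not> crossing (insert v A) B"
        using insert.prems(3) A B unfolding laminar_def by blast+
      moreover have "A \<noteq> {}" "B \<noteq> {}"
        using insert.prems(5) A B by blast+
      ultimately show False
        using A(3) B(3,4) unfolding crossing_def by blast
    qed
    then have "card (L - {insert v A}) = card (?r ` (L - {insert v A}))"
      by (simp add: card_image)
    also have "\<dots> \<le> card (?r ` L)"
      using finL by (intro card_mono) auto
    finally show ?thesis
      using A(2) finL by simp
  qed
  with IH show ?case
    using insert.hyps by simp
qed

section \<open>Weights and cuts\<close>

definition weight :: "'e set \<Rightarrow> ('e \<Rightarrow> real) \<Rightarrow> ('e \<Rightarrow> real) \<Rightarrow> real" where
  "weight E c x = (\<Sum>e\<in>E. c e * x e)"

lemma linear_weight: "linear (weight E c)"
  by (rule linearI)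
    (auto simp: weight_def sum.distrib sum_distrib_left algebra_simps)

lemma weight_indicator_cut:
  assumes "finite E"
  shows "weight E c (indicator (cut E S)) = sum c (cut E S)"
proof -
  have "weight E c (indicator (cut E S)) = (\<Sum>e\<in>E. if e \<in> cut E S then c e else 0)"
    unfolding weight_def by (rule sum.cong) (auto simp: indicator_def)
  also have "\<dots> = sum c (E \<inter> cut E S)"
    using assms by (simp add: sum.inter_restrict)
  also have "E \<inter> cut E S = cut E S"
    by (auto simp: cut_def)
  finally show ?thesis .
qed

lemma subspace_coord_space: "subspace (coord_space E)"
  by (auto simp: subspace_def coord_space_def)

lemma indicator_cut_in_coord_space: "indicator (cut E S) \<in> coord_space E"
  by (auto simp: coord_space_def cut_def indicator_def)

lemma edge_in_cut_iff:
  assumes "{u, v} \<in> E" "u \<noteq> v"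
  shows "{u, v} \<in> cut E S \<longleftrightarrow> (u \<in> S) \<noteq> (v \<in> S)"
  using assms by (cases "u \<in> S"; cases "v \<in> S") (simp_all add: cut_def)

lemma indicator_cut_outside: "e \<notin> E \<Longrightarrow> indicator (cut E S) e = (0 :: real)"
  by (auto simp: cut_def indicator_def)

lemma simple_graph_edgeE:
  assumes "simple_graph V E" "e \<in> E"
  obtains u v where "u \<in> V" "v \<in> V" "u \<noteq> v" "e = {u, v}"
  using assms unfolding simple_graph_def by blast

lemma finite_edges:
  assumes "simple_graph V E"
  shows "finite E"
proof (rule finite_subset)
  show "E \<subseteq> Pow V"
    using assms by (auto simp: simple_graph_def)
  show "finite (Pow V)"
    using assms by (simp add: simple_graph_def)
qed

lemma cut_complement:
  assumes "simple_graph V E"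
  shows "cut E (V - S) = cut E S"
proof -
  have "e \<in> cut E (V - S) \<longleftrightarrow> e \<in> cut E S" if "e \<in> E" for e
    using assms that by (elim simple_graph_edgeE) (auto simp: edge_in_cut_iff)
  then show ?thesis
    by (auto simp: cut_def)
qed

text \<open>Checked edge by edge; only edges between \<open>A - B\<close> and \<open>B - A\<close>
  give strict inequality. The form with incidence vectors rather than weights yields an identity of
  vectors in the tight case, as the span argument requires.\<close>

lemma cut_submodular:
  assumes "simple_graph V E"
  shows "indicator (cut E (A \<inter> B)) e + indicator (cut E (A \<union> B)) e
    \<le> indicator (cut E A) e + (indicator (cut E B) e :: real)"
proof (cases "e \<in> E")
  case True
  with assms obtain u v where "u \<noteq> v" "e = {u, v}"
    by (elim simple_graph_edgeE)
  with True show ?thesis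
    by (auto simp: indicator_def edge_in_cut_iff)
qed (simp add: indicator_cut_outside)

text \<open>This is submodularity for \<open>A\<close> and the complement of \<open>B\<close>; only
  edges between \<open>A \<inter> B\<close> and the outside of \<open>A \<union> B\<close> give
  strict inequality.\<close>

lemma cut_posimodular:
  assumes "simple_graph V E"
  shows "indicator (cut E (A - B)) e + indicator (cut E (B - A)) e
    \<le> indicator (cut E A) e + (indicator (cut E B) e :: real)"
proof (cases "e \<in> E")
  case True
  with assms obtain u v where "u \<noteq> v" "e = {u, v}"
    by (elim simple_graph_edgeE)
  with True show ?thesis
    by (auto simp: indicator_def edge_in_cut_iff)
qed (simp add: indicator_cut_outside)

text \<open>The weighted deficits \<open>c e * (p e + q e - p' e - q' e)\<close> are nonnegative,
  but their sum is at most \<open>2 * g - 2 * g\<close>. Hence all vanish, and positivity of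
  \<open>c\<close> turns this into equality of coordinates.\<close>

lemma tight_exchange:
  fixes c p q p' q' :: "'e \<Rightarrow> real"
  assumes "finite E" and pos: "\<And>e. e \<in> E \<Longrightarrow> c e > 0"
    and "p \<in> coord_space E" "q \<in> coord_space E" "p' \<in> coord_space E" "q' \<in> coord_space E"
    and le: "\<And>e. p' e + q' e \<le> p e + q e"
    and "weight E c p = g" "weight E c q = g" "weight E c p' \<ge> g" "weight E c q' \<ge> g"
  shows "weight E c p' = g" "weight E c q' = g" "p + q = p' + q'"
proof -
  have sum: "(\<Sum>e\<in>E. c e * (p e + q e - p' e - q' e))
      = weight E c p + weight E c q - weight E c p' - weight E c q'"
    by (simp add: weight_def algebra_simps sum.distrib sum_subtractf)
  have nonneg: "c e * (p e + q e - p' e - q' e) \<ge> 0" if "e \<in> E" for e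
    using pos[OF that] le[of e] by simp
  then have ge: "(\<Sum>e\<in>E. c e * (p e + q e - p' e - q' e)) \<ge> 0"
    by (rule sum_nonneg)
  then show "weight E c p' = g" "weight E c q' = g"
    using sum assms by linarith+
  then have "(\<Sum>e\<in>E. c e * (p e + q e - p' e - q' e)) = 0"
    using sum assms by linarith
  then have "\<forall>e\<in>E. c e * (p e + q e - p' e - q' e) = 0"
    using nonneg assms(1) by (subst (asm) sum_nonneg_eq_0_iff) auto
  then have "p e + q e = p' e + q' e" if "e \<in> E" for e
    using that pos[OF that] by force
  moreover have "p e + q e = p' e + q' e" if "e \<notin> E" for e
    using that assms(3-6) by (simp add: coord_space_def)
  ultimately show "p + q = p' + q'"
    by (auto simp: fun_eq_iff)
qed

section \<open>Uncrossing minimum Steiner cuts\<close>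

text \<open>Of the two complementary shores of a cut the one without \<open>t\<close> is chosen.
  Unions then still avoid the terminal \<open>t\<close>, so they again give Steiner cuts.\<close>

definition min_shores :: "('v set \<Rightarrow> real) \<Rightarrow> 'v steiner \<Rightarrow> 'v \<Rightarrow> 'v set set" where
  "min_shores c G t = {S. S \<subseteq> nodes G - {t} \<and> S \<inter> terminals G \<noteq> {} \<and>
     sum c (cut (edges G) S) = min_steiner_cut c G}"

abbreviation cut_vec :: "'v steiner \<Rightarrow> 'v set \<Rightarrow> 'v set \<Rightarrow> real" where
  "cut_vec G S \<equiv> indicator (cut (edges G) S)"

lemma steiner_graph_imp_simple_graph:
  "steiner_graph G \<Longrightarrow> simple_graph (nodes G) (edges G)"
  by (simp add: steiner_graph_def)

lemma finite_edges_steiner_graph: "steiner_graph G \<Longrightarrow> finite (edges G)"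
  by (rule finite_edges[OF steiner_graph_imp_simple_graph])

lemma finite_min_shores:
  assumes "steiner_graph G"
  shows "finite (min_shores c G t)"
proof (rule finite_subset)
  show "min_shores c G t \<subseteq> Pow (nodes G)"
    by (auto simp: min_shores_def)
  show "finite (Pow (nodes G))"
    using assms by (simp add: steiner_graph_def simple_graph_def)
qed

lemma finite_steiner_cuts:
  assumes "steiner_graph G"
  shows "finite (steiner_cuts G)"
proof (rule finite_subset)
  show "steiner_cuts G \<subseteq> Pow (edges G)"
    by (auto simp: steiner_cuts_def cut_def)
  show "finite (Pow (edges G))"
    using assms by (simp add: finite_edges_steiner_graph)
qed

lemma min_steiner_cut_le:
  assumes "steiner_graph G" "D \<in> steiner_cuts G"
  shows "min_steiner_cut c G \<le> sum c D"
  using assms finite_steiner_cuts unfolding min_steiner_cut_def by (intro Min_le) auto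

lemma steiner_cut_shoreI:
  assumes "t \<in> terminals G" "S \<subseteq> nodes G - {t}" "S \<inter> terminals G \<noteq> {}"
  shows "cut (edges G) S \<in> steiner_cuts G"
  using assms unfolding steiner_cuts_def by blast

text \<open>If the given shore contains \<open>t\<close>, its complement has the same cut and
  contains a terminal, because the cut separates terminals.\<close>

lemma steiner_cut_shoreE:
  assumes "steiner_graph G" "t \<in> terminals G" "D \<in> steiner_cuts G"
  obtains S where "S \<subseteq> nodes G - {t}" "S \<inter> terminals G \<noteq> {}" "D = cut (edges G) S"
proof -
  obtain S where S: "S \<subseteq> nodes G" "terminals G \<inter> S \<noteq> {}" "terminals G - S \<noteq> {}"
      "D = cut (edges G) S"
    using assms(3) unfolding steiner_cuts_def by blast
  have "terminals G \<subseteq> nodes G" "simple_graph (nodes G) (edges G)"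
    using assms(1) by (auto simp: steiner_graph_def)
  then show thesis
    using that[of S] that[of "nodes G - S"] S assms(2)
    by (cases "t \<in> S") (auto simp: cut_complement)
qed

context
  fixes G :: "'v steiner" and c :: "'v set \<Rightarrow> real" and t :: 'v
  assumes G: "steiner_graph G" and t: "t \<in> terminals G"
    and pos: "\<And>e. e \<in> edges G \<Longrightarrow> c e > 0"
begin

text \<open>\<open>R\<close> and \<open>R'\<close> give Steiner cuts, so they weigh at least the
  minimum and \<open>tight_exchange\<close> applies. The identity is solved for \<open>S\<close> so
  that \<open>S\<close> can be eliminated from a spanning set.\<close>

lemma shore_exchange:
  assumes S: "S \<in> min_shores c G t" "S' \<in> min_shores c G t"
    and R: "R \<subseteq> nodes G - {t}" "R \<inter> terminals G \<noteq> {}"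
      "R' \<subseteq> nodes G - {t}" "R' \<inter> terminals G \<noteq> {}"
    and le: "\<And>e. cut_vec G R e + cut_vec G R' e \<le> cut_vec G S e + cut_vec G S' e"
  shows "R \<in> min_shores c G t" "R' \<in> min_shores c G t"
    "cut_vec G S = cut_vec G R + cut_vec G R' - cut_vec G S'"
proof -
  note weight_cut_vec = weight_indicator_cut[OF finite_edges_steiner_graph[OF G]]
  have ge: "weight (edges G) c (cut_vec G R) \<ge> min_steiner_cut c G"
    "weight (edges G) c (cut_vec G R') \<ge> min_steiner_cut c G"
    using R t G by (auto simp: weight_cut_vec intro!: min_steiner_cut_le steiner_cut_shoreI)
  have eq: "weight (edges G) c (cut_vec G S) = min_steiner_cut c G"
    "weight (edges G) c (cut_vec G S') = min_steiner_cut c G"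
    using S by (auto simp: weight_cut_vec min_shores_def)
  note ex = tight_exchange[OF finite_edges_steiner_graph[OF G] pos indicator_cut_in_coord_space
      indicator_cut_in_coord_space indicator_cut_in_coord_space indicator_cut_in_coord_space
      le eq ge]
  show "R \<in> min_shores c G t" "R' \<in> min_shores c G t"
    using ex(1,2) R by (auto simp: weight_cut_vec min_shores_def)
  show "cut_vec G S = cut_vec G R + cut_vec G R' - cut_vec G S'"
    using ex(3) by (simp add: eq_diff_eq)
qed

text \<open>If \<open>S\<close> and \<open>S'\<close> share a terminal, both intersection and union
  contain it; otherwise the terminals of each shore survive in its difference from the other. The
  clauses on crossing ensure that uncrossing creates no new conflict with sets that do not cross
  \<open>S'\<close>.\<close>

lemma uncross:
  assumes S: "S \<in> min_shores c G t" "S' \<in> min_shores c G t" and cr: "crossing S S'"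
  obtains R R' where "R \<in> min_shores c G t" "R' \<in> min_shores c G t"
    "cut_vec G S = cut_vec G R + cut_vec G R' - cut_vec G S'"
    "\<not> crossing S' R" "\<not> crossing S' R'"
    "\<And>Q. \<not> crossing Q S' \<Longrightarrow> crossing Q R \<or> crossing Q R' \<Longrightarrow> crossing Q S"
proof (cases "S \<inter> S' \<inter> terminals G = {}")
  case False
  have sub: "S \<inter> S' \<subseteq> nodes G - {t}" "S \<inter> S' \<inter> terminals G \<noteq> {}"
    "S \<union> S' \<subseteq> nodes G - {t}" "(S \<union> S') \<inter> terminals G \<noteq> {}"
    using S False by (auto simp: min_shores_def)
  note ex = shore_exchange[OF S sub cut_submodular[OF steiner_graph_imp_simple_graph[OF G]]]
  show thesis
  proof (rule that[OF ex])
    show "\<not> crossing S' (S \<inter> S')" "\<not> crossing S' (S \<union> S')"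
      unfolding crossing_def by blast+
    show "crossing Q S" if "\<not> crossing Q S'" "crossing Q (S \<inter> S') \<or> crossing Q (S \<union> S')" for Q
      using that cr unfolding crossing_def by blast
  qed
next
  case True
  have sub: "S - S' \<subseteq> nodes G - {t}" "(S - S') \<inter> terminals G \<noteq> {}"
    "S' - S \<subseteq> nodes G - {t}" "(S' - S) \<inter> terminals G \<noteq> {}"
    using S True by (auto simp: min_shores_def)
  note ex = shore_exchange[OF S sub cut_posimodular[OF steiner_graph_imp_simple_graph[OF G]]]
  show thesis
  proof (rule that[OF ex])
    show "\<not> crossing S' (S - S')" "\<not> crossing S' (S' - S)"
      unfolding crossing_def by blast+
    show "crossing Q S" if "\<not> crossing Q S'" "crossing Q (S - S') \<or> crossing Q (S' - S)" for Q
      using that cr unfolding crossing_def by blast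
  qed
qed

text \<open>An inclusion-maximal laminar \<open>L\<close> works, by induction on the number of its
  members crossing \<open>S\<close>. If there are none, maximality puts \<open>S\<close> into
  \<open>L\<close>; otherwise uncrossing expresses the vector of \<open>S\<close> by a member of
  \<open>L\<close> and two shores with fewer conflicts.\<close>

lemma laminar_spanning_family:
  obtains L where "L \<subseteq> min_shores c G t" "laminar L"
    "cut_vec G ` min_shores c G t \<subseteq> span (cut_vec G ` L)"
proof -
  let ?F = "{L. L \<subseteq> min_shores c G t \<and> laminar L}"
  have "finite ?F" "?F \<noteq> {}"
    using finite_min_shores[OF G] by (auto simp: laminar_def)
  then obtain L where L: "L \<in> ?F" and maxL: "\<And>L'. L' \<in> ?F \<Longrightarrow> L \<subseteq> L' \<Longrightarrow> L' = L"
    using finite_has_maximal[of ?F] by metis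
  have finL: "finite L"
    using L finite_min_shores[OF G] finite_subset by blast
  have "cut_vec G S \<in> span (cut_vec G ` L)" if "S \<in> min_shores c G t" for S
    using that
  proof (induction "card {Q \<in> L. crossing Q S}" arbitrary: S rule: less_induct)
    case less
    show ?case
    proof (cases "\<exists>S'\<in>L. crossing S' S")
      case False
      then have "laminar (insert S L)"
        using L unfolding laminar_def by (auto simp: crossing_commute) (auto simp: crossing_def)
      then have "S \<in> L"
        using maxL[of "insert S L"] L less.prems by blast
      then show ?thesis
        by (intro span_base) auto
    next
      case True
      then obtain S' where S': "S' \<in> L" "crossing S' S"
        by blast
      then have "S' \<in> min_shores c G t" "crossing S S'"
        using L by (auto simp: crossing_commute)
      then obtain R R' where R: "R \<in> min_shores c G t" "R' \<in> min_shores c G t"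
        "cut_vec G S = cut_vec G R + cut_vec G R' - cut_vec G S'"
        "\<not> crossing S' R" "\<not> crossing S' R'"
        "\<And>Q. \<not> crossing Q S' \<Longrightarrow> crossing Q R \<or> crossing Q R' \<Longrightarrow> crossing Q S"
        using uncross[OF less.prems] by metis
      have noc: "\<not> crossing Q S'" if "Q \<in> L" for Q
        using that S' L unfolding laminar_def by blast
      \<comment> \<open>Members crossing a new shore already cross \<open>S\<close>, as none crosses
        \<open>S'\<close>. The inclusion is strict because \<open>S'\<close> crosses
        \<open>S\<close> but neither new shore.\<close>
      have "{Q \<in> L. crossing Q R} \<subset> {Q \<in> L. crossing Q S}"
        "{Q \<in> L. crossing Q R'} \<subset> {Q \<in> L. crossing Q S}"
        using R(4-6) noc S' by blast+
      then have "cut_vec G R \<in> span (cut_vec G ` L)" "cut_vec G R' \<in> span (cut_vec G ` L)"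
        using finL R(1,2) by (auto intro!: less.hyps psubset_card_mono)
      moreover have "cut_vec G S' \<in> span (cut_vec G ` L)"
        using S' by (intro span_base) auto
      ultimately show ?thesis
        unfolding R(3) by (intro span_add span_diff)
    qed
  qed
  then show thesis
    using that L by blast
qed

end

section \<open>Facets\<close>

text \<open>The dimension is a Hilbert choice, so an affine basis must be exhibited before its
  defining property can be used. As \<open>card\<close> is 0 on infinite sets, finiteness of
  \<open>B\<close> is not implied here.\<close>

lemma affine_dim_basis:
  obtains B where "affine hull B = affine hull V" "\<not> affine_dependent B"
    "int (card B) = affine_dim V + 1"
proof -
  obtain B0 where "B0 \<subseteq> V" "\<not> affine_dependent B0" "affine hull V = affine hull B0"
    using affine_basis_exists by blast
  then have "\<exists>d :: int. \<exists>B. affine hull B = affine hull V \<and> \<not> affine_dependent B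
      \<and> of_nat (card B) = d + 1"
    by (intro exI[of _ "int (card B0) - 1"] exI[of _ B0]) auto
  then have "\<exists>B. affine hull B = affine hull V \<and> \<not> affine_dependent B
      \<and> of_nat (card B) = affine_dim V + 1"
    unfolding affine_dim_def by (rule someI_ex)
  then show thesis
    using that by auto
qed

text \<open>Applying \<open>l\<close> to a vanishing linear combination gives coefficient sum times
  \<open>g\<close> equal to 0, so the coefficients sum to 0 and the relation is an affine
  one.\<close>

lemma independent_of_affine_independent_hyperplane:
  assumes "\<not> affine_dependent B" "linear l" "\<And>b. b \<in> B \<Longrightarrow> l b = (g :: real)" "g \<noteq> 0"
  shows "independent B"
proof
  assume "dependent B"
  then obtain S u where S: "finite S" "S \<subseteq> B" "\<exists>v\<in>S. u v \<noteq> 0" "(\<Sum>v\<in>S. u v *\<^sub>R v) = 0"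
    unfolding dependent_explicit by blast
  have "0 = l (\<Sum>v\<in>S. u v *\<^sub>R v)"
    using S(4) assms(2) by (simp add: linear_0)
  also have "\<dots> = (\<Sum>v\<in>S. u v * l v)"
    using assms(2) by (simp add: linear_sum linear_scale)
  also have "\<dots> = sum u S * g"
    using S(2) assms(3) by (auto simp: sum_distrib_right intro!: sum.cong)
  finally have "sum u S = 0"
    using assms(4) by simp
  then have "affine_dependent B"
    unfolding affine_dependent_explicit using S by blast
  with assms(1) show False
    by blast
qed

section \<open>Coordinate vectors and the dimension of the cut dominant\<close>

definition unit_vec :: "'e \<Rightarrow> 'e \<Rightarrow> real" where
  "unit_vec e = indicator {e}"

lemma inj_unit_vec: "inj unit_vec"
proof (rule injI)
  fix a b :: 'e
  assume "unit_vec a = unit_vec b"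
  then have "unit_vec a a = unit_vec b a"
    by simp
  then show "a = b"
    by (simp add: unit_vec_def indicator_def split: if_splits)
qed


lemma linear_eval: "linear (\<lambda>x :: 'e \<Rightarrow> real. x e)"
  by (rule linearI) auto

lemma independent_unit_vec: "independent (unit_vec ` E)"
proof
  assume "dependent (unit_vec ` E)"
  then obtain S u v where S: "finite S" "S \<subseteq> unit_vec ` E" "v \<in> S" "u v \<noteq> 0"
      "(\<Sum>w\<in>S. u w *\<^sub>R w) = 0"
    unfolding dependent_explicit by blast
  then obtain e where e: "v = unit_vec e"
    by blast
  have "0 = (\<Sum>w\<in>S. u w *\<^sub>R w) e"
    using S(5) by simp
  also have "\<dots> = (\<Sum>w\<in>S. u w * w e)"
    using linear_sum[OF linear_eval[of e], of "\<lambda>w. u w *\<^sub>R w" S] by simp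
  also have "\<dots> = (\<Sum>w\<in>S. if w = v then u v else 0)"
  proof (rule sum.cong)
    fix w assume "w \<in> S"
    then obtain e' where e': "w = unit_vec e'"
      using S(2) by blast
    then have "w = v \<longleftrightarrow> e' = e"
      using e inj_eq[OF inj_unit_vec] by metis
    moreover have "w e = (if e' = e then 1 else 0)"
      using e' by (simp add: unit_vec_def indicator_def)
    ultimately show "u w * w e = (if w = v then u v else 0)"
      by auto
  qed simp
  also have "\<dots> = u v"
    using S(1,3) by simp
  finally show False
    using S(4) by simp
qed

lemma coord_space_subset_span:
  assumes "finite E"
  shows "coord_space E \<subseteq> span (unit_vec ` E)"
proof
  fix x assume x: "x \<in> coord_space E"
  have "x y = (\<Sum>e\<in>E. x e *\<^sub>R unit_vec e) y" for y
  proof -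
    have "(\<Sum>e\<in>E. x e *\<^sub>R unit_vec e) y = (\<Sum>e\<in>E. x e * unit_vec e y)"
      using linear_sum[OF linear_eval[of y], of "\<lambda>e. x e *\<^sub>R unit_vec e" E] by simp
    also have "\<dots> = (\<Sum>e\<in>E. if e = y then x y else 0)"
      by (rule sum.cong) (auto simp: unit_vec_def indicator_def)
    also have "\<dots> = x y"
      using x assms by (auto simp: coord_space_def)
    finally show ?thesis ..
  qed
  then have "x = (\<Sum>e\<in>E. x e *\<^sub>R unit_vec e)"
    by blast
  also have "\<dots> \<in> span (unit_vec ` E)"
    by (intro span_sum span_scale span_base) auto
  finally show "x \<in> span (unit_vec ` E)" .
qed

text \<open>Differences of points of \<open>P\<close> give every unit vector, so the direction space
  of its affine hull has dimension at least \<open>card E\<close>.\<close>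

lemma card_le_affine_dim:
  assumes fin: "finite E" and P: "P \<subseteq> coord_space E" "p \<in> P"
    and unit: "\<And>e. e \<in> E \<Longrightarrow> p + unit_vec e \<in> P"
  shows "int (card E) \<le> affine_dim P"
proof -
  obtain B where B: "affine hull B = affine hull P" "\<not> affine_dependent B"
      "int (card B) = affine_dim P + 1"
    by (rule affine_dim_basis)
  have "B \<noteq> {}"
    using B(1) P(2) by (metis affine_hull_eq_empty empty_iff)
  then obtain a where a: "a \<in> B"
    by blast
  let ?W = "(\<lambda>x. - a + x) ` (B - {a})"
  have hull: "affine hull P = (\<lambda>x. a + x) ` span ?W"
    using affine_hull_span2[OF a] B(1) by simp
  have indep: "independent ?W"
    using affine_dependent_iff_dependent2[OF a] B(2) by simp
  have "B \<subseteq> coord_space E"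
    using B(1) P(1) subspace_imp_affine[OF subspace_coord_space]
    by (metis hull_minimal hull_subset order_trans)
  then have "- a + x \<in> coord_space E" if "x \<in> B" for x
    using that a subspace_coord_space by (metis subsetD subspace_add subspace_neg)
  \<comment> \<open>An independent set in a finitely spanned space is finite; this rules out an
    infinite \<open>B\<close> with default cardinality 0.\<close>
  then have "?W \<subseteq> span (unit_vec ` E)"
    using coord_space_subset_span[OF fin] by blast
  then have finW: "finite ?W"
    using independent_span_bound[OF _ indep] fin by blast
  have inj: "inj_on (\<lambda>x. - a + x) (B - {a})"
    by (rule inj_onI) simp
  then have finB: "finite B"
    using finW finite_imageD by fastforce
  have "unit_vec e \<in> span ?W" if "e \<in> E" for e
  proof -
    have "p \<in> affine hull P" "p + unit_vec e \<in> affine hull P"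
      using P(2) unit[OF that] by (auto intro: hull_inc)
    then obtain w w' where w: "w \<in> span ?W" "w' \<in> span ?W" "p = a + w" "p + unit_vec e = a + w'"
      unfolding hull by blast
    then have "unit_vec e = w' - w"
      by (metis add_diff_cancel_left add_diff_cancel_left')
    then show ?thesis
      using w(1,2) by (simp add: span_diff)
  qed
  then have "card (unit_vec ` E) \<le> card ?W"
    using independent_span_bound[OF finW independent_unit_vec] by blast
  then have "card E \<le> card (B - {a})"
    using inj by (simp add: card_image inj_on_subset[OF inj_unit_vec])
  \<comment> \<open>The base point \<open>a\<close> is the one element by which an affine basis
    exceeds a basis of directions.\<close>
  also have "\<dots> = card B - 1"
    using a finB by simp
  finally have "card E + 1 \<le> card B"
    using a finB by (metis One_nat_def Suc_eq_plus1 Suc_leI card_gt_0_iff empty_iff le_diff_conv2)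
  then show ?thesis
    using B(3) by linarith
qed

lemma steiner_cuts_nonempty:
  assumes "steiner_graph G"
  shows "steiner_cuts G \<noteq> {}"
proof -
  have T: "terminals G \<subseteq> nodes G" "card (terminals G) \<ge> 2"
    using assms by (auto simp: steiner_graph_def)
  then obtain t where t: "t \<in> terminals G"
    by fastforce
  with T obtain s where "s \<in> terminals G" "s \<noteq> t" "s \<in> nodes G"
    by (metis card_le_Suc0_iff_eq card.infinite not_less_eq_eq numeral_2_eq_2 subsetD t
        zero_le order.refl)
  then have "cut (edges G) {s} \<in> steiner_cuts G"
    using t by (intro steiner_cut_shoreI) auto
  then show ?thesis
    by blast
qed

text \<open>Adding the nonnegative orthant lets any cut vector be shifted by every unit vector
  within the dominant.\<close>

lemma card_edges_le_affine_dim: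
  fixes G :: "'v steiner"
  assumes "steiner_graph G"
  shows "int (card (edges G)) \<le> affine_dim (cut_dominant G)"
proof -
  have hull: "convex hull (indicator ` steiner_cuts G) \<subseteq> coord_space (edges G)"
  proof (rule hull_minimal)
    show "indicator ` steiner_cuts G \<subseteq> coord_space (edges G)"
      by (auto simp: steiner_cuts_def indicator_cut_in_coord_space)
    show "convex (coord_space (edges G))"
      by (rule subspace_imp_convex[OF subspace_coord_space])
  qed
  obtain D where "D \<in> steiner_cuts G"
    using steiner_cuts_nonempty[OF assms] by blast
  then have D: "indicator D \<in> convex hull (indicator ` steiner_cuts G)"
    by (intro hull_inc) auto
  show ?thesis
  proof (rule card_le_affine_dim)
    show "finite (edges G)"
      using assms(1) by (rule finite_edges_steiner_graph)
    show "cut_dominant G \<subseteq> coord_space (edges G)"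
      using hull by (auto simp: cut_dominant_def intro!: subspace_add[OF subspace_coord_space])
    have "indicator D = indicator D + (0 :: 'v set \<Rightarrow> real)" "0 \<in> coord_space (edges G)"
      "\<forall>e\<in>edges G. (0 :: 'v set \<Rightarrow> real) e \<ge> 0"
      by (simp_all add: coord_space_def)
    then show "indicator D \<in> cut_dominant G"
      using D unfolding cut_dominant_def by blast
    show "indicator D + unit_vec e \<in> cut_dominant G" if "e \<in> edges G" for e
    proof -
      have "unit_vec e \<in> coord_space (edges G)" "\<forall>e'\<in>edges G. unit_vec e e' \<ge> 0"
        using that by (auto simp: unit_vec_def coord_space_def indicator_def)
      then show ?thesis
        using D unfolding cut_dominant_def by blast
    qed
  qed
qed

section \<open>Tight points of the facet and the bound on the number of edges\<close>

context
  fixes G :: "'v steiner" and c :: "'v set \<Rightarrow> real" and t :: 'v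
  assumes G: "steiner_graph G" and t: "t \<in> terminals G" and c: "facet_weights c G"
begin

lemma tight_in_span:
  assumes x: "x \<in> cut_dominant G" "weight (edges G) c x = min_steiner_cut c G"
  shows "x \<in> span (cut_vec G ` min_shores c G t)"
proof -
  let ?E = "edges G" and ?g = "min_steiner_cut c G"
  let ?M = "span (cut_vec G ` min_shores c G t)"
  let ?Q = "{x. weight ?E c x \<ge> ?g \<and> (weight ?E c x = ?g \<longrightarrow> x \<in> ?M)}"
  have pos: "\<And>e. e \<in> ?E \<Longrightarrow> c e > 0"
    using c by (simp add: facet_weights_def)
  have finE: "finite ?E"
    using G by (rule finite_edges_steiner_graph)
  note lin = linear_add[OF linear_weight] linear_scale[OF linear_weight]
  \<comment> \<open>The excess of weight over \<open>?g\<close> is nonnegative on \<open>?Q\<close>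
    and combines convexly. If it vanishes for a combination, each point with nonzero coefficient is
    tight, hence in \<open>?M\<close>.\<close>
  have "convex ?Q"
  proof (rule convexI)
    fix y z :: "'v set \<Rightarrow> real" and u v :: real
    assume y: "y \<in> ?Q" and z: "z \<in> ?Q" and uv: "u \<ge> 0" "v \<ge> 0" "u + v = 1"
    have "u * ?g + v * ?g = ?g"
      using uv(3) by (simp flip: distrib_right)
    then have w: "weight ?E c (u *\<^sub>R y + v *\<^sub>R z) - ?g
        = u * (weight ?E c y - ?g) + v * (weight ?E c z - ?g)"
      by (simp add: lin right_diff_distrib)
    have nn: "u * (weight ?E c y - ?g) \<ge> 0" "v * (weight ?E c z - ?g) \<ge> 0"
      using y z uv by simp_all
    have "u *\<^sub>R y + v *\<^sub>R z \<in> ?M" if "weight ?E c (u *\<^sub>R y + v *\<^sub>R z) = ?g"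
    proof -
      have "u * (weight ?E c y - ?g) = 0" "v * (weight ?E c z - ?g) = 0"
        using that w nn by linarith+
      then have "u = 0 \<or> y \<in> ?M" "v = 0 \<or> z \<in> ?M"
        using y z by auto
      then have "u *\<^sub>R y \<in> ?M" "v *\<^sub>R z \<in> ?M"
        by (auto intro: span_scale span_zero)
      then show ?thesis
        by (rule span_add)
    qed
    then show "u *\<^sub>R y + v *\<^sub>R z \<in> ?Q"
      using w nn by auto
  qed
  moreover have "indicator ` steiner_cuts G \<subseteq> ?Q"
  proof (rule image_subsetI)
    fix D assume D: "D \<in> steiner_cuts G"
    then obtain S where S: "S \<subseteq> nodes G - {t}" "S \<inter> terminals G \<noteq> {}" "D = cut ?E S"
      using steiner_cut_shoreE[OF G t] by metis
    have "weight ?E c (indicator D) = sum c D"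
      unfolding S(3) using finE by (rule weight_indicator_cut)
    moreover have "indicator D \<in> ?M" if "sum c D = ?g"
      using S that by (intro span_base) (auto simp: min_shores_def)
    ultimately show "indicator D \<in> ?Q"
      using min_steiner_cut_le[OF G D] by simp
  qed
  ultimately have hull: "convex hull (indicator ` steiner_cuts G) \<subseteq> ?Q"
    by (rule hull_minimal[rotated])
  obtain p r where pr: "x = p + r" "p \<in> convex hull (indicator ` steiner_cuts G)"
      "r \<in> coord_space ?E" "\<And>e. e \<in> ?E \<Longrightarrow> r e \<ge> 0"
    using x(1) unfolding cut_dominant_def by blast
  have p: "weight ?E c p \<ge> ?g" "weight ?E c p = ?g \<Longrightarrow> p \<in> ?M"
    using hull pr(2) by auto
  have nn: "c e * r e \<ge> 0" if "e \<in> ?E" for e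
    using pos[OF that] pr(4)[OF that] by simp
  have "weight ?E c r \<ge> 0"
    unfolding weight_def using nn by (rule sum_nonneg)
  then have eq: "weight ?E c r = 0" "weight ?E c p = ?g"
    using x(2) p(1) pr(1) lin(1)[of ?E c p r] by simp_all
  \<comment> \<open>A tight point leaves no weight for the orthant part \<open>r\<close>, and since
    \<open>c\<close> is positive, \<open>r\<close> must vanish.\<close>
  have "\<forall>e\<in>?E. c e * r e = 0"
    using eq(1) nn finE unfolding weight_def by (subst (asm) sum_nonneg_eq_0_iff) auto
  then have "r e = 0" for e
    using pos[of e] pr(3) by (cases "e \<in> ?E") (auto simp: coord_space_def)
  then have "r = 0"
    by auto
  then show ?thesis
    using p(2) eq(2) pr(1) by simp
qed

text \<open>An affine basis of the facet has \<open>affine_dim ?F + 1\<close>, hence at least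
  \<open>card (edges G)\<close>, elements. They lie on a hyperplane with positive right-hand side,
  so they are linearly independent, and they lie in the span of a laminar family of shores.\<close>

lemma card_edges_le_nonterminals: "card (edges G) \<le> card (nodes G - terminals G) + 2 ^ card (terminals G)"
proof -
  let ?E = "edges G" and ?g = "min_steiner_cut c G"
  let ?F = "{x \<in> cut_dominant G. weight ?E c x = ?g}"
  have pos: "\<And>e. e \<in> ?E \<Longrightarrow> c e > 0" and g: "?g > 0"
    and facet: "affine_dim ?F = affine_dim (cut_dominant G) - 1"
    using c by (auto simp: facet_weights_def defines_facet_def is_facet_of_def weight_def)
  obtain L where L: "L \<subseteq> min_shores c G t" "laminar L"
      "cut_vec G ` min_shores c G t \<subseteq> span (cut_vec G ` L)"
    by (rule laminar_spanning_family[OF G t pos])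
  have finV: "finite (nodes G)" and TV: "terminals G \<subseteq> nodes G"
    using G by (auto simp: steiner_graph_def simple_graph_def)
  have finL: "finite L"
    by (rule finite_subset[OF L(1) finite_min_shores[OF G]])
  obtain B where B: "affine hull B = affine hull ?F" "\<not> affine_dependent B"
      "int (card B) = affine_dim ?F + 1"
    by (rule affine_dim_basis)
  have "affine {x. weight ?E c x = ?g}"
    unfolding affine_def
    by (auto simp: linear_add[OF linear_weight] linear_scale[OF linear_weight] simp flip: distrib_right)
  then have "affine hull ?F \<subseteq> {x. weight ?E c x = ?g}"
    by (intro hull_minimal) auto
  then have "weight ?E c b = ?g" if "b \<in> B" for b
    using that B(1) hull_subset[of B affine] by blast
  then have indep: "independent B"
    using g by (intro independent_of_affine_independent_hyperplane[OF B(2) linear_weight]) auto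
  have "?F \<subseteq> span (cut_vec G ` L)"
    using tight_in_span span_minimal[OF L(3) subspace_span] by blast
  then have "affine hull ?F \<subseteq> span (cut_vec G ` L)"
    by (intro hull_minimal subspace_imp_affine subspace_span)
  then have "B \<subseteq> span (cut_vec G ` L)"
    using B(1) hull_subset[of B affine] by blast
  then have "card B \<le> card (cut_vec G ` L)"
    using independent_span_bound[OF _ indep] finL by blast
  also have "\<dots> \<le> card L"
    using finL by (rule card_image_le)
  also have "\<dots> \<le> card (nodes G - terminals G) + 2 ^ card (terminals G)"
    using L finV TV finite_subset
    by (intro card_laminar_le) (auto simp: min_shores_def)
  finally show ?thesis
    using B(3) facet card_edges_le_affine_dim[OF G] by linarith
qed

end

section \<open>Counting nodes\<close>

lemma sum_node_degree:
  assumes "simple_graph V E"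
  shows "(\<Sum>v\<in>V. node_degree E v) = 2 * card E"
proof -
  have fin: "finite V" "finite E"
    using assms finite_edges by (auto simp: simple_graph_def)
  have "card {v \<in> V. v \<in> e} = 2" if "e \<in> E" for e
  proof -
    obtain u v where "u \<in> V" "v \<in> V" "u \<noteq> v" "e = {u, v}"
      using assms \<open>e \<in> E\<close> by (rule simple_graph_edgeE)
    moreover then have "{w \<in> V. w \<in> e} = {u, v}"
      by auto
    ultimately show ?thesis
      by simp
  qed
  then show ?thesis
    unfolding node_degree_def using fin
    by (intro sum_multicount) auto
qed

lemma connected_graph_edgeE:
  assumes "connected_graph V E" "u \<in> V" "v \<in> V" "u \<noteq> v"
  obtains w where "{u, w} \<in> E"
proof -
  have "(u, v) \<in> {(a, b). {a, b} \<in> E}\<^sup>*"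
    using assms by (simp add: connected_graph_def)
  then show thesis
    using that assms(4) by (cases rule: converse_rtranclE) auto
qed

text \<open>Connectedness excludes degree 0 and irreducibility degree 2. If \<open>v\<close> had a
  single neighbour \<open>w\<close>, deleting \<open>w\<close> would isolate \<open>v\<close> from a
  terminal other than \<open>w\<close>, making \<open>w\<close> a cut node.\<close>

lemma degree_ge_3:
  assumes irr: "irreducible_facet_inducing G" and v: "v \<in> nodes G - terminals G"
  shows "node_degree (edges G) v \<ge> 3"
proof -
  let ?V = "nodes G" and ?E = "edges G"
  have simple: "simple_graph ?V ?E" and conn: "connected_graph ?V ?E"
    and T: "terminals G \<subseteq> ?V" "card (terminals G) \<ge> 2"
    using irr by (auto simp: irreducible_facet_inducing_def facet_inducing_def steiner_graph_def)
  have finI: "finite {e \<in> ?E. v \<in> e}"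
    using finite_edges[OF simple] by simp
  have ex: "\<exists>x\<in>terminals G. x \<noteq> w" for w
    using T(2) by (metis card_le_Suc0_iff_eq card.infinite not_less_eq_eq numeral_2_eq_2 zero_le)
  obtain s where "s \<in> terminals G"
    using ex by blast
  then obtain w where w: "{v, w} \<in> ?E"
    using connected_graph_edgeE[OF conn, of v s] v T by blast
  then have "w \<in> ?V" "w \<noteq> v"
    using simple by (auto elim!: simple_graph_edgeE simp: doubleton_eq_iff)
  have "node_degree ?E v \<noteq> 0"
    using w finI by (auto simp: node_degree_def)
  moreover have "node_degree ?E v \<noteq> 1"
  proof
    assume "node_degree ?E v = 1"
    then obtain e where e: "{e \<in> ?E. v \<in> e} = {e}"
      unfolding node_degree_def by (auto simp: card_1_singleton_iff)
    have uniq: "e' = {v, w}" if "e' \<in> ?E" "v \<in> e'" for e'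
    proof -
      have "e' \<in> {e}" "{v, w} \<in> {e}"
        unfolding e[symmetric] using that w by simp_all
      then show ?thesis
        by simp
    qed
    obtain x where x: "x \<in> terminals G" "x \<noteq> w"
      using ex by blast
    have "\<not> cut_node ?V ?E w"
      using irr by (simp add: irreducible_facet_inducing_def)
    then have "connected_graph (?V - {w}) {e \<in> ?E. w \<notin> e}"
      using \<open>w \<in> ?V\<close> by (simp add: cut_node_def)
    then obtain y where "{v, y} \<in> {e \<in> ?E. w \<notin> e}"
      using connected_graph_edgeE[of _ _ v x] x v T \<open>w \<noteq> v\<close> by blast
    then show False
      using uniq[of "{v, y}"] by auto
  qed
  moreover have "node_degree ?E v \<noteq> 2"
    using irr v by (simp add: irreducible_facet_inducing_def)
  ultimately show ?thesis
    by linarith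
qed

lemma card_nodes_le:
  assumes irr: "irreducible_facet_inducing G"
  shows "card (nodes G) \<le> card (terminals G) + 2 * 2 ^ card (terminals G)"
proof -
  let ?V = "nodes G" and ?E = "edges G" and ?T = "terminals G"
  have G: "steiner_graph G" and simple: "simple_graph ?V ?E" and T: "?T \<subseteq> ?V" "card ?T \<ge> 2"
    and fin: "finite ?V"
    using irr by (auto simp: irreducible_facet_inducing_def facet_inducing_def steiner_graph_def
        simple_graph_def)
  obtain c where c: "facet_weights c G"
    using irr by (auto simp: irreducible_facet_inducing_def facet_inducing_def)
  obtain t where t: "t \<in> ?T"
    using T(2) by fastforce
  \<comment> \<open>Incidences at nonterminals are counted against \<open>2 * card ?E\<close>; the
    edge bound contributes only \<open>2 * card (?V - ?T)\<close>, so one copy of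
    \<open>card (?V - ?T)\<close> remains on the left.\<close>
  have "3 * card (?V - ?T) = (\<Sum>v\<in>?V - ?T. 3)"
    by simp
  also have "\<dots> \<le> (\<Sum>v\<in>?V - ?T. node_degree ?E v)"
    by (intro sum_mono degree_ge_3[OF irr])
  also have "\<dots> \<le> (\<Sum>v\<in>?V. node_degree ?E v)"
    using fin by (intro sum_mono2) auto
  also have "\<dots> = 2 * card ?E"
    by (rule sum_node_degree[OF simple])
  also have "\<dots> \<le> 2 * (card (?V - ?T) + 2 ^ card ?T)"
    using card_edges_le_nonterminals[OF G t c] by simp
  finally have "card (?V - ?T) \<le> 2 * 2 ^ card ?T"
    by simp
  moreover have "card (?V - ?T) = card ?V - card ?T"
    using fin T(1) finite_subset by (intro card_Diff_subset) auto
  ultimately show ?thesis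
    by linarith
qed

section \<open>Isomorphism classes\<close>

text \<open>Transport along an enumeration of the nodes. This removes the infinitely many choices of
  node names, leaving representatives determined by their size, edges and terminals.\<close>

lemma ex_isomorphic_on_initial_segment:
  fixes G :: "nat steiner"
  assumes G: "steiner_graph G"
  obtains H where "(G, H) \<in> steiner_iso_rel" "nodes H = {..<card (nodes G)}"
proof -
  have simple: "simple_graph (nodes G) (edges G)" and fin: "finite (nodes G)"
    using G by (auto simp: steiner_graph_def simple_graph_def)
  obtain h where "bij_betw h (nodes G) {0..<card (nodes G)}"
    using ex_bij_betw_finite_nat[OF fin] by blast
  then have h: "bij_betw h (nodes G) {..<card (nodes G)}"
    by (simp add: atLeast0LessThan)
  then have inj: "inj_on h (nodes G)" and im: "h ` nodes G = {..<card (nodes G)}"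
    by (auto simp: bij_betw_def)
  define H :: "nat steiner" where
    "H = \<lparr>nodes = h ` nodes G, edges = (`) h ` edges G, terminals = h ` terminals G\<rparr>"
  have sub: "e \<subseteq> nodes G" if "e \<in> edges G" for e
    using simple that by (auto simp: simple_graph_def)
  have edge: "{h u, h v} \<in> edges H \<longleftrightarrow> {u, v} \<in> edges G" if "u \<in> nodes G" "v \<in> nodes G" for u v
  proof
    assume "{h u, h v} \<in> edges H"
    then obtain e where e: "e \<in> edges G" "h ` {u, v} = h ` e"
      by (auto simp: H_def)
    then have "{u, v} = e"
      using inj_on_image_eq_iff[OF inj] sub that by (metis empty_subsetI insert_subset)
    then show "{u, v} \<in> edges G"
      using e by simp
  next
    assume "{u, v} \<in> edges G"
    then have "h ` {u, v} \<in> (`) h ` edges G"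
      by (rule imageI)
    then show "{h u, h v} \<in> edges H"
      by (simp add: H_def)
  qed
  have path: "(h u, h v) \<in> {(a, b). {a, b} \<in> edges H}\<^sup>*"
    if "(u, v) \<in> {(a, b). {a, b} \<in> edges G}\<^sup>*" for u v
    using that
  proof (induction rule: rtrancl_induct)
    case (step y z)
    then have "{h y, h z} \<in> edges H"
      using sub[of "{y, z}"] edge by blast
    then show ?case
      using step.IH by (auto intro: rtrancl_into_rtrancl)
  qed simp
  have "simple_graph (nodes H) (edges H)"
    unfolding simple_graph_def
  proof (intro conjI ballI)
    fix e assume "e \<in> edges H"
    then obtain e' where "e' \<in> edges G" "e = h ` e'"
      by (auto simp: H_def)
    then obtain u v where "u \<in> nodes G" "v \<in> nodes G" "u \<noteq> v" "e = {h u, h v}"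
      using simple by (auto elim: simple_graph_edgeE)
    then show "\<exists>u\<in>nodes H. \<exists>v\<in>nodes H. u \<noteq> v \<and> e = {u, v}"
      using inj by (auto simp: H_def inj_on_def)
  qed (simp add: H_def fin)
  moreover have "connected_graph (nodes H) (edges H)"
    using G path by (auto simp: steiner_graph_def connected_graph_def H_def)
  moreover have "terminals H \<subseteq> nodes H" "card (terminals H) \<ge> 2"
    using G by (auto simp: steiner_graph_def H_def card_image inj_on_subset[OF inj])
  ultimately have "steiner_graph H"
    by (simp add: steiner_graph_def)
  moreover have "steiner_iso G H"
    unfolding steiner_iso_def using h im edge by (intro exI[of _ h]) (auto simp: H_def)
  ultimately have "(G, H) \<in> steiner_iso_rel"
    using G by (simp add: steiner_iso_rel_def)
  then show thesis
    using that im by (simp add: H_def)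
qed

lemma finite_steiner_graphs_on:
  assumes "finite V"
  shows "finite {G :: 'v steiner. steiner_graph G \<and> nodes G \<subseteq> V}"
proof (rule finite_subset)
  let ?mk = "\<lambda>(N, E, T). \<lparr>nodes = N, edges = E, terminals = T\<rparr> :: 'v steiner"
  show "{G :: 'v steiner. steiner_graph G \<and> nodes G \<subseteq> V}
      \<subseteq> ?mk ` (Pow V \<times> Pow (Pow V) \<times> Pow V)"
  proof
    fix G :: "'v steiner"
    assume G: "G \<in> {G. steiner_graph G \<and> nodes G \<subseteq> V}"
    then have "nodes G \<subseteq> V" "edges G \<subseteq> Pow V" "terminals G \<subseteq> V"
      by (auto simp: steiner_graph_def simple_graph_def)
    moreover have "G = ?mk (nodes G, edges G, terminals G)"
      by simp
    ultimately show "G \<in> ?mk ` (Pow V \<times> Pow (Pow V) \<times> Pow V)"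
      by blast
  qed
  show "finite (?mk ` (Pow V \<times> Pow (Pow V) \<times> Pow V))"
    using assms by simp
qed

text \<open>Each class has a representative with nodes in \<open>{..<n}\<close>, and only finitely
  many Steiner graphs live there.\<close>

lemma finite_quotient_of_bounded:
  assumes "\<And>G. G \<in> X \<Longrightarrow> steiner_graph G \<and> card (nodes G) \<le> n"
  shows "finite ((X :: nat steiner set) // steiner_iso_rel)"
proof (rule finite_subset)
  let ?Y = "{H :: nat steiner. steiner_graph H \<and> nodes H \<subseteq> {..<n}}"
  show "X // steiner_iso_rel \<subseteq> (\<lambda>H. steiner_iso_rel `` {H}) ` ?Y"
  proof
    fix C assume "C \<in> X // steiner_iso_rel"
    then obtain G where G: "G \<in> X" "C = steiner_iso_rel `` {G}"
      by (rule quotientE)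
    then obtain H where H: "(G, H) \<in> steiner_iso_rel" "nodes H = {..<card (nodes G)}"
      using assms ex_isomorphic_on_initial_segment by metis
    have "C = steiner_iso_rel `` {H}"
      using G(2) equiv_class_eq[OF equiv_steiner_iso_rel H(1)] by simp
    moreover have "H \<in> ?Y"
      using H assms[OF G(1)] by (auto simp: steiner_iso_rel_def)
    ultimately show "C \<in> (\<lambda>H. steiner_iso_rel `` {H}) ` ?Y"
      by blast
  qed
  show "finite ((\<lambda>H. steiner_iso_rel `` {H}) ` ?Y)"
    by (intro finite_imageI finite_steiner_graphs_on) simp
qed

text \<open>Every finite graph has a copy on natural numbers, so node type \<open>nat\<close> covers
  all isomorphism types.\<close>

theorem theorem4:
  shows "\<exists>f :: nat \<Rightarrow> nat. \<forall>\<tau>\<ge>2.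
    finite ({G :: nat steiner. irreducible_facet_inducing G \<and> card (terminals G) = \<tau>} // steiner_iso_rel) \<and>
    card ({G :: nat steiner. irreducible_facet_inducing G \<and> card (terminals G) = \<tau>} // steiner_iso_rel) \<le> f \<tau>"
proof -
  have "finite ({G :: nat steiner. irreducible_facet_inducing G \<and> card (terminals G) = \<tau>}
      // steiner_iso_rel)" for \<tau>
    by (rule finite_quotient_of_bounded[where n = "\<tau> + 2 * 2 ^ \<tau>"])
      (use card_nodes_le in \<open>auto simp: irreducible_facet_inducing_def facet_inducing_def\<close>)
  \<comment> \<open>Once finiteness is known, the number of classes itself serves as
    \<open>f \<tau>\<close>.\<close>
  then show ?thesis
    by (intro exI[of _ "\<lambda>\<tau>. card ({G :: nat steiner. irreducible_facet_inducing G
      \<and> card (terminals G) = \<tau>} // steiner_iso_rel)"]) simp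
qed

end
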